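(* For every integer $n \geq 3$ there is a $4$-digit solution for $n$ and there is a $5$-digit solution for $n$.
   Context: For integers $n \geq 2$, $h \geq 1$ and $a_0,\dots,a_h$, write $(a_h,a_{h-1},\dots,a_1,a_0)_n = a_h n^h + a_{h-1}n^{h-1} + \cdots + a_1 n + a_0$. An $(h+1)$-digit solution for $n$ is an integer $(a_h,a_{h-1},\dots,a_1,a_0)_n$ with $0 \leq a_i \leq n-1$ for all $i$, $a_0 \neq 0$, $a_h \neq 0$, for which there is an integer $k$ with $1<k<n$ and $k(a_h,a_{h-1},\dots,a_1,a_0)_n = (a_0,a_1,\dots,a_{h-1},a_h)_n$. *)

theory Defs
  imports Main
begin

text \<open>
  The digit sequence \<open>a\<close> is least significant first: \<open>base_val n h a\<close> is
  \<open>(a\<^sub>h, \<dots>, a\<^sub>1, a\<^sub>0)\<^sub>n\<close>, and only the values \<open>a i\<close> with \<open>i \<le> h\<close> matter.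
\<close>

definition base_val :: "int \<Rightarrow> nat \<Rightarrow> (nat \<Rightarrow> int) \<Rightarrow> int" where
  "base_val n h a = (\<Sum>i=0..h. a i * n ^ i)"

text \<open>The first argument is the number of digits, \<open>h + 1\<close>.\<close>

definition digit_solution :: "nat \<Rightarrow> int \<Rightarrow> int \<Rightarrow> bool" where
  "digit_solution d n N \<longleftrightarrow>
     (\<exists>(h::nat) (a::nat \<Rightarrow> int).
        d = h + 1 \<and> h \<ge> 1 \<and> n \<ge> 2 \<and>
        N = base_val n h a \<and>
        (\<forall>i\<le>h. 0 \<le> a i \<and> a i \<le> n - 1) \<and>
        a 0 \<noteq> 0 \<and> a h \<noteq> 0 \<and>
        (\<exists>k::int. 1 < k \<and> k < n \<and>
           k * base_val n h a = base_val n h (\<lambda>i. a (h - i))))"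

end

theory Submission
  imports Defs
begin

text \<open>
  In base ten, \<open>9 \<cdot> 1089 = 9801\<close> and \<open>9 \<cdot> 10989 = 98901\<close>. Both identities survive in every base
  \<open>n \<ge> 3\<close>, with \<open>n - 1\<close> in the role of \<open>9\<close>. The reason is that \<open>1089 = 99 \<cdot> 11\<close> and
  \<open>10989 = 99 \<cdot> 111\<close> are instances of \<open>(n\<^sup>2 - 1) \<cdot> R\<close>, where \<open>R\<close> is a repunit
  \<open>1 + n + \<dots> + n ^ (m - 1)\<close>. Since \<open>(n - 1) \<cdot> R = n ^ m - 1\<close>, one gets
    \<open>(n\<^sup>2 - 1) \<cdot> R = (n + 1) \<cdot> (n ^ m - 1) = n ^ (m + 1) + n ^ m - n - 1\<close> and
    \<open>(n - 1) \<cdot> (n\<^sup>2 - 1) \<cdot> R = (n\<^sup>2 - 1) \<cdot> (n ^ m - 1) = n ^ (m + 2) - n ^ m - n\<^sup>2 + 1\<close>.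
  For \<open>m \<ge> 2\<close>, carrying out the borrows in the two right-hand sides gives the digits
  \<open>1, 0, n - 1, \<dots>, n - 1, n - 2, n - 1\<close> and \<open>n - 1, n - 2, n - 1, \<dots>, n - 1, 0, 1\<close>,
  each the reversal of the other. The cases \<open>m = 2\<close> and \<open>m = 3\<close> have four and five digits.
  The bound \<open>n \<ge> 3\<close> is what makes the multiplier \<open>n - 1\<close> exceed \<open>1\<close>.
\<close>

lemma digit_solution_4:
  fixes n :: int
  assumes "n \<ge> 3"
  shows "digit_solution 4 n (base_val n 3 (\<lambda>i. [n - 1, n - 2, 0, 1] ! i))"
proof -
  let ?a = "\<lambda>i. [n - 1, n - 2, 0, 1] ! i"
  have digits: "\<forall>i\<le>3. 0 \<le> ?a i \<and> ?a i \<le> n - 1"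
    using assms by (auto simp: numeral_eq_Suc le_Suc_eq)
  have reversal: "(n - 1) * base_val n 3 ?a = base_val n 3 (\<lambda>i. ?a (3 - i))"
    by (simp add: base_val_def numeral_eq_Suc algebra_simps)
  have "1 < n - 1" "n - 1 < n" using assms by auto
  with reversal have "\<exists>k>1. k < n \<and> k * base_val n 3 ?a = base_val n 3 (\<lambda>i. ?a (3 - i))"
    by blast
  with digits assms show ?thesis
    unfolding digit_solution_def by (intro exI[of _ 3] exI[of _ ?a]) auto
qed

lemma digit_solution_5:
  fixes n :: int
  assumes "n \<ge> 3"
  shows "digit_solution 5 n (base_val n 4 (\<lambda>i. [n - 1, n - 2, n - 1, 0, 1] ! i))"
proof -
  let ?a = "\<lambda>i. [n - 1, n - 2, n - 1, 0, 1] ! i"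
  have digits: "\<forall>i\<le>4. 0 \<le> ?a i \<and> ?a i \<le> n - 1"
    using assms by (auto simp: numeral_eq_Suc le_Suc_eq)
  have reversal: "(n - 1) * base_val n 4 ?a = base_val n 4 (\<lambda>i. ?a (4 - i))"
    by (simp add: base_val_def numeral_eq_Suc algebra_simps)
  have "1 < n - 1" "n - 1 < n" using assms by auto
  with reversal have "\<exists>k>1. k < n \<and> k * base_val n 4 ?a = base_val n 4 (\<lambda>i. ?a (4 - i))"
    by blast
  with digits assms show ?thesis
    unfolding digit_solution_def by (intro exI[of _ 4] exI[of _ ?a]) auto
qed

theorem corollary1:
  fixes n :: int
  assumes "n \<ge> 3"
  shows "(\<exists>N. digit_solution 4 n N) \<and> (\<exists>N. digit_solution 5 n N)"
  using digit_solution_4[OF assms] digit_solution_5[OF assms] by blast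

end
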